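(* Let $$\varphi_S(z)=1+\sin z,\qquad \varphi_R(z)=1+\frac{z(1+\sqrt2+z)}{(1+\sqrt2)(1+\sqrt2-z)},\qquad z\in\mathbb D.$$ Then the sharp $\mathcal S^*(\varphi_R)$-radius of $\mathcal S^*(\varphi_S)$ is $$R_{\mathcal S^*(\varphi_R)}(\mathcal S^*(\varphi_S))=\arcsin(3-2\sqrt2).$$
   Context: Let $\mathbb D=\{z\in\mathbb C:|z|<1\}$ and let $\mathcal A$ be the class of functions $f$ analytic on $\mathbb D$ with $f(0)=0$ and $f'(0)=1$. For an analytic function $\varphi$ on $\mathbb D$ with $\varphi(0)=1$, the class $\mathcal S^*(\varphi)$ consists of all $f\in\mathcal A$ with $zf'(z)/f(z)\prec\varphi(z)$; that is, there is an analytic $\omega:\mathbb D\to\mathbb D$ with $\omega(0)=0$ such that $zf'(z)/f(z)=\varphi(\omega(z))$ on $\mathbb D$ (the quotient takes the value $1$ at $z=0$, and $f$ has no other zeros). For two such functions $\varphi_1,\varphi_2$, the sharp $\mathcal S^*(\varphi_2)$-radius of $\mathcal S^*(\varphi_1)$ is $$R_{\mathcal S^*(\varphi_2)}(\mathcal S^*(\varphi_1))=\sup\left\{r\in(0,1]: f_r(z)=\tfrac{f(rz)}{r}\text{ belongs to }\mathcal S^*(\varphi_2)\text{ for every } f\in\mathcal S^*(\varphi_1)\right\}.$$ *)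

theory Defs
  imports "HOL-Complex_Analysis.Complex_Analysis"
begin

text \<open>
  Functions on the unit disc are total functions of which only the values on
  \<^term>\<open>ball 0 1\<close> matter.
\<close>

definition class_A :: "(complex \<Rightarrow> complex) set" where
  "class_A = {f. f holomorphic_on ball 0 1 \<and> f 0 = 0 \<and> deriv f 0 = 1}"

definition subordinate :: "(complex \<Rightarrow> complex) \<Rightarrow> (complex \<Rightarrow> complex) \<Rightarrow> bool"
    (infix "\<prec>\<^sub>s" 50) where
  "g \<prec>\<^sub>s h \<longleftrightarrow>
     (\<exists>\<omega>. \<omega> holomorphic_on ball 0 1 \<and> \<omega> ` ball 0 1 \<subseteq> ball 0 1 \<and> \<omega> 0 = 0 \<and>
          (\<forall>z\<in>ball 0 1. g z = h (\<omega> z)))"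

text \<open>
  The quotient \<open>z f'(z) / f(z)\<close>, with its removable singularity at the origin filled in.
\<close>

definition star_quotient :: "(complex \<Rightarrow> complex) \<Rightarrow> complex \<Rightarrow> complex" where
  "star_quotient f z = (if z = 0 then 1 else z * deriv f z / f z)"

text \<open>
  Division by zero is total in HOL, so the absence of further zeros of \<open>f\<close>, implicit in
  the quotient being defined on the disc, is stated explicitly. The classes are meant for
  \<open>\<phi>\<close> holomorphic on the disc with \<open>\<phi> 0 = 1\<close>.
\<close>

definition starlike_class :: "(complex \<Rightarrow> complex) \<Rightarrow> (complex \<Rightarrow> complex) set" where
  "starlike_class \<phi> =
     {f \<in> class_A. (\<forall>z\<in>ball 0 1 - {0}. f z \<noteq> 0) \<and> star_quotient f \<prec>\<^sub>s \<phi>}"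

definition dilate :: "real \<Rightarrow> (complex \<Rightarrow> complex) \<Rightarrow> complex \<Rightarrow> complex" where
  "dilate r f z = f (of_real r * z) / of_real r"

text \<open>
  The sharp \<open>S\<^sup>*(\<phi>2)\<close>-radius of \<open>S\<^sup>*(\<phi>1)\<close>; note the order of the arguments. The set is
  bounded above by 1; its supremum is meaningful whenever it is nonempty.
\<close>

definition starlike_radius :: "(complex \<Rightarrow> complex) \<Rightarrow> (complex \<Rightarrow> complex) \<Rightarrow> real" where
  "starlike_radius \<phi>2 \<phi>1 =
     Sup {r \<in> {0<..1}. \<forall>f\<in>starlike_class \<phi>1. dilate r f \<in> starlike_class \<phi>2}"

definition phi_S :: "complex \<Rightarrow> complex" where
  "phi_S z = 1 + sin z"

definition phi_R :: "complex \<Rightarrow> complex" where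
  "phi_R z = 1 + z * (1 + of_real (sqrt 2) + z) /
     ((1 + of_real (sqrt 2)) * (1 + of_real (sqrt 2) - z))"

lemma phi_S_admissible: "phi_S holomorphic_on ball 0 1" "phi_S 0 = 1"
  unfolding phi_S_def by (auto intro!: holomorphic_intros)

lemma phi_R_admissible: "phi_R holomorphic_on ball 0 1" "phi_R 0 = 1"
proof -
  have k: "1 + complex_of_real (sqrt 2) = of_real (1 + sqrt 2)"
    by simp
  have "of_real (1 + sqrt 2) - z \<noteq> 0" if "z \<in> ball 0 1" for z :: complex
  proof
    assume "of_real (1 + sqrt 2) - z = 0"
    then have "norm z = \<bar>1 + sqrt 2\<bar>"
      by (metis norm_of_real right_minus_eq)
    with that show False
      by simp
  qed
  moreover have "complex_of_real (1 + sqrt 2) \<noteq> 0"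
    by (metis add_pos_pos less_irrefl of_real_eq_0_iff real_sqrt_gt_zero zero_less_numeral zero_less_one)
  ultimately show "phi_R holomorphic_on ball 0 1"
    unfolding phi_R_def k by (intro holomorphic_intros) auto
  show "phi_R 0 = 1"
    by (simp add: phi_R_def)
qed

end

theory Submission
  imports Defs
begin

text \<open>
  With \<open>\<sigma> = 1 + \<surd>2\<close>, so that \<open>\<sigma>\<^sup>-\<^sup>2 = 3 - 2\<surd>2\<close>, the equation \<open>phi_R z = 1 + w\<close> is quadratic in
  \<open>z\<close> with discriminant proportional to \<open>(w + \<sigma>\<^sup>-\<^sup>2) (w + \<sigma>\<^sup>2)\<close>. Its root vanishing at \<open>w = 0\<close> is
  holomorphic on the cap \<open>Re w > -\<sigma>\<^sup>-\<^sup>2, |w| < 1/2\<close>, and it cannot reach modulus \<open>1\<close> there, because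
  the curve \<open>phi_R (e\<^sup>i\<^sup>t) - 1\<close> avoids the cap. The sine maps the disc of radius
  \<open>arcsin (\<sigma>\<^sup>-\<^sup>2)\<close> into the cap, so the Schwarz lemma gives the subordination for that radius. A larger
  radius fails for the extremal function with \<open>z f'/f = 1 + sin z\<close>: it would make \<open>phi_R\<close> attain
  \<open>1 - \<sigma>\<^sup>-\<^sup>2\<close> inside the disc, whereas \<open>-1\<close> is the double root of the corresponding quadratic.
\<close>

section \<open>Arithmetic of the silver ratio\<close>

definition silver :: real where "silver = 1 + sqrt 2"

lemma silver_sq: "silver^2 = 2 * silver + 1"
  by (simp add: silver_def power2_sum)

lemma silver_bounds: "12/5 < silver" "silver < 5/2"
proof -
  have "sqrt (49/25) < sqrt 2" "sqrt 2 < sqrt (9/4)"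
    by (intro real_sqrt_less_mono; simp)+
  then show "12/5 < silver" "silver < 5/2"
    by (simp_all add: silver_def real_sqrt_divide)
qed

lemma inverse_silver_sq: "inverse (silver^2) = 5 - 2 * silver"
proof (rule inverse_unique)
  show "silver^2 * (5 - 2 * silver) = 1"
    unfolding silver_sq using silver_sq by (simp add: algebra_simps power2_eq_square)
qed

lemma silver_neq:
  assumes "norm z \<le> 1"
  shows "complex_of_real silver - z \<noteq> 0"
proof
  assume "complex_of_real silver - z = 0"
  then have "norm z = \<bar>silver\<bar>"
    by (metis norm_of_real right_minus_eq)
  with assms silver_bounds show False by simp
qed

section \<open>The quadratic equation and the boundary curve of \<open>phi_R\<close>\<close>

lemma phi_R_eq_iff:
  assumes "norm z \<le> 1"
  shows "phi_R z = 1 + w \<longleftrightarrow> z^2 + of_real silver * z * (1 + w) = of_real (silver^2) * w"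
proof -
  have s: "1 + complex_of_real (sqrt 2) = of_real silver"
    by (simp add: silver_def)
  have "complex_of_real silver \<noteq> 0"
    using silver_bounds by simp
  then show ?thesis
    using silver_neq[OF assms] unfolding phi_R_def s
    by (auto simp: divide_simps) (simp_all add: algebra_simps power2_eq_square)
qed

text \<open>
  At its critical point \<open>-1\<close> the boundary curve of \<open>phi_R\<close> has a cusp pointing into the image,
  so nearby points of the curve lie to the left of the cusp.
\<close>

lemma phi_R_circle:
  assumes z: "norm z = 1" and eq: "phi_R z = 1 + w"
  shows "Re w \<le> - inverse (silver^2) \<or> 1/2 \<le> norm w"
proof -
  define x y u v where "x = Re z" and "y = Im z" and "u = Re w" and "v = Im w"
  define s where "s = silver"
  have ss: "s * s = 2 * s + 1" and s: "12/5 < s" "s < 5/2"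
    using silver_sq silver_bounds by (simp_all add: s_def power2_eq_square)
  have xy: "x^2 + y^2 = 1"
    using z by (simp add: x_def y_def cmod_power2 [symmetric])
  then have x1: "-1 \<le> x" "x \<le> 1"
    using abs_Re_le_cmod[of z] z by (auto simp: x_def)
  have e: "z * (of_real s + z) = w * of_real s * (of_real s - z)"
    using eq z phi_R_eq_iff[of z w] by (simp add: s_def algebra_simps power2_eq_square)
  have re: "s * x + x^2 - y^2 = s * (u * (s - x) + v * y)"
    using arg_cong[OF e, of Re]
    by (simp add: x_def y_def u_def v_def algebra_simps power2_eq_square)
  have im: "s * y + 2 * x * y = s * (v * (s - x) - u * y)"
    using arg_cong[OF e, of Im]
    by (simp add: x_def y_def u_def v_def algebra_simps power2_eq_square)
  have d: "(s - x)^2 + y^2 = 2 * s * (s - 1 - x)"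
    using xy ss by algebra
  \<comment> \<open>Real part of \<open>e\<close> after multiplication by the conjugate of
    \<open>s - z\<close>; comparing squared moduli in \<open>e\<close> gives \<open>N\<close>
    below.\<close>
  have "s * u * ((s - x)^2 + y^2) = (s * x + x^2 - y^2) * (s - x) - (s * y + 2 * x * y) * y"
    unfolding re im by algebra
  also have "\<dots> = 2 * s * (x^2 + x - 1)"
    using xy ss by algebra
  finally have "2 * s * (s * u * (s - 1 - x)) = 2 * s * (x^2 + x - 1)"
    unfolding d by algebra
  then have U: "s * u * (s - 1 - x) = x^2 + x - 1"
    using s by simp
  have "s^2 * (u^2 + v^2) * ((s - x)^2 + y^2) = (s * x + x^2 - y^2)^2 + (s * y + 2 * x * y)^2"
    unfolding re im by algebra
  also have "\<dots> = 2 * s * (s - 1 + x)"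
    using xy ss by algebra
  finally have "2 * s * (s^2 * (u^2 + v^2) * (s - 1 - x)) = 2 * s * (s - 1 + x)"
    unfolding d by algebra
  then have N: "s^2 * (u^2 + v^2) * (s - 1 - x) = s - 1 + x"
    using s by simp
  have pos: "s - 1 - x > 0"
    using x1 s by simp
  show ?thesis
  \<comment> \<open>Since (s - 2)/s = 1/s^2, the bound on \<open>u\<close> amounts to (x + 1)(x + 2
    - s) \<le> 0, where x = -1 is the cusp. Past the other root, s - 1 - x < 1 and \<open>N\<close>
    makes \<open>w\<close> large.\<close>
  proof (cases "x \<le> s - 2")
    case True
    then have "(x + 1) * (x + 2 - s) \<le> 0"
      using x1 by (intro mult_nonneg_nonpos) auto
    moreover have "s * u * (s - 1 - x) + (s - 2) * (s - 1 - x) = (x + 1) * (x + 2 - s)"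
      unfolding U using ss by algebra
    ultimately have "s * u * (s - 1 - x) \<le> - (s - 2) * (s - 1 - x)"
      unfolding minus_mult_left [symmetric] by linarith
    then have "s * u \<le> - (s - 2)"
      using pos mult_right_le_imp_le by blast
    also have "\<dots> = s * - (5 - 2 * s)"
      using ss by (simp add: algebra_simps)
    finally have "u \<le> - (5 - 2 * s)"
      using s by (subst (asm) mult_le_cancel_left_pos) auto
    then show ?thesis
      by (simp add: u_def s_def inverse_silver_sq)
  next
    case False
    have "s^2 * (u^2 + v^2) * (s - 1 - x) \<le> s^2 * (u^2 + v^2) * 1"
      using False by (intro mult_left_mono) auto
    then have "2 * s - 3 \<le> s^2 * (u^2 + v^2)"
      using N False by simp
    moreover have "s^2 * (1/4) \<le> 2 * s - 3"
      using ss s by (simp add: power2_eq_square)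
    ultimately have "s^2 * (1/4) \<le> s^2 * (u^2 + v^2)"
      by linarith
    then have "(1/2)^2 \<le> (norm w)^2"
      unfolding cmod_power2 using s
      by (subst (asm) mult_le_cancel_left_pos) (auto simp: u_def v_def power2_eq_square)
    then show ?thesis
      using power2_le_imp_le norm_ge_zero by blast
  qed
qed

section \<open>The inverse branch of \<open>phi_R\<close> on the cap\<close>

text \<open>The quadratic formula for the equation in \<open>phi_R_eq_iff\<close>. The root of the
  discriminant is taken factor by factor, so that holomorphy only needs each radicand off the branch
  cut.\<close>

definition phi_R_inv :: "complex \<Rightarrow> complex" where
  "phi_R_inv w = of_real silver / 2 *
     (csqrt (w + of_real (inverse (silver^2))) * csqrt (w + of_real (silver^2)) - (1 + w))"

text \<open>The negation of the conclusion of \<open>phi_R_circle\<close>.\<close>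

definition phi_R_region :: "complex set" where
  "phi_R_region = {w. - inverse (silver^2) < Re w \<and> norm w < 1/2}"

lemma zero_in_phi_R_region: "0 \<in> phi_R_region"
  using silver_bounds by (simp add: phi_R_region_def)

lemma convex_phi_R_region: "convex phi_R_region"
proof -
  have "phi_R_region = {w. Re w > - inverse (silver^2)} \<inter> ball 0 (1/2)"
    by (auto simp: phi_R_region_def)
  then show ?thesis
    by (metis convex_Int convex_halfspace_Re_gt convex_ball)
qed

lemma phi_R_inv_0: "phi_R_inv 0 = 0"
proof -
  have "silver > 0"
    using silver_bounds by simp
  then show ?thesis
    by (simp add: phi_R_inv_def real_sqrt_inverse flip: of_real_mult of_real_power of_real_inverse)
qed

lemma holomorphic_phi_R_inv: "phi_R_inv holomorphic_on phi_R_region"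
proof -
  have "inverse (silver^2) < silver^2"
    unfolding inverse_silver_sq unfolding silver_sq using silver_bounds by simp
  then have "w + of_real c \<notin> \<real>\<^sub>\<le>\<^sub>0"
    if "w \<in> phi_R_region" "c \<in> {inverse (silver^2), silver^2}" for w c
    using that unfolding phi_R_region_def complex_nonpos_Reals_iff
    by (auto simp del: power_inverse of_real_power of_real_inverse)
  then show ?thesis
    unfolding phi_R_inv_def by (intro holomorphic_intros) blast+
qed

lemma phi_R_inv_root:
  "(phi_R_inv w)^2 + of_real silver * phi_R_inv w * (1 + w) = of_real (silver^2) * w"
proof -
  define s a b where "s = complex_of_real silver"
    and "a = csqrt (w + of_real (inverse (silver^2)))" and "b = csqrt (w + of_real (silver^2))"
  have a: "a^2 = w + of_real (5 - 2 * silver)"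
    unfolding a_def inverse_silver_sq by simp
  have b: "b^2 = w + of_real (2 * silver + 1)"
    unfolding b_def silver_sq by simp
  have s: "s^2 = 2 * s + 1"
    unfolding s_def by (metis of_real_1 of_real_add of_real_mult of_real_numeral of_real_power silver_sq)
  have "a^2 = w + (5 - 2 * s)" "b^2 = w + (2 * s + 1)"
    using a b by (simp_all add: s_def)
  \<comment> \<open>The shifts are s^(-2) and s^2, with product 1 and sum 6.\<close>
  then have ab: "(a * b)^2 = w^2 + 6 * w + 1"
    using s unfolding power_mult_distrib by algebra
  have g: "phi_R_inv w = s / 2 * (a * b - (1 + w))"
    by (simp only: phi_R_inv_def s_def a_def b_def)
  have "4 * ((s / 2 * (a * b - (1 + w)))^2 + s * (s / 2 * (a * b - (1 + w))) * (1 + w))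
      = s^2 * ((a * b)^2 - (1 + w)^2)"
    by (simp add: field_simps power2_eq_square)
  also have "\<dots> = 4 * (s^2 * w)"
    unfolding ab by algebra
  finally show ?thesis
    unfolding g s_def [symmetric] of_real_power by (simp only: mult_cancel_left) simp
qed

text \<open>On the segment from 0 to \<open>w\<close> the modulus starts at 0, so reaching 1 or more
  would force the value 1 at some point of the cap, against \<open>phi_R_circle\<close>.\<close>

lemma norm_phi_R_inv_less:
  assumes w: "w \<in> phi_R_region"
  shows "norm (phi_R_inv w) < 1"
proof (rule ccontr)
  assume "\<not> ?thesis"
  then have ge: "1 \<le> norm (phi_R_inv w)" by simp
  have seg: "of_real t * w \<in> phi_R_region" if "0 \<le> t" "t \<le> 1" for t
    using convexD[OF convex_phi_R_region w zero_in_phi_R_region, of t "1 - t"] that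
    by (simp add: scaleR_conv_of_real)
  have "continuous_on {0..1} (\<lambda>t. norm (phi_R_inv (of_real t * w)))"
    using seg
    by (intro continuous_intros
        continuous_on_compose2[OF holomorphic_on_imp_continuous_on[OF holomorphic_phi_R_inv]]) auto
  then obtain t where t: "0 \<le> t" "t \<le> 1" "norm (phi_R_inv (of_real t * w)) = 1"
    using IVT'[of "\<lambda>t. norm (phi_R_inv (of_real t * w))" 0 1 1] ge phi_R_inv_0 by auto
  have "phi_R (phi_R_inv (of_real t * w)) = 1 + of_real t * w"
    using t(3) by (subst phi_R_eq_iff) (auto simp: phi_R_inv_root)
  from phi_R_circle[OF t(3) this] seg[OF t(1,2)] show False
    by (auto simp: phi_R_region_def)
qed

lemma phi_R_phi_R_inv:
  assumes "w \<in> phi_R_region"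
  shows "phi_R (phi_R_inv w) = 1 + w"
  using norm_phi_R_inv_less[OF assms] by (subst phi_R_eq_iff) (auto simp: phi_R_inv_root)

text \<open>At this value the linear coefficient is s - 1/s = 2 with s = \<open>silver\<close>, and
  the quadratic becomes (z + 1)^2 = 0.\<close>

lemma phi_R_neq_cusp:
  assumes "norm z < 1"
  shows "phi_R z \<noteq> 1 - of_real (inverse (silver^2))"
proof
  assume "phi_R z = 1 - of_real (inverse (silver^2))"
  then have "phi_R z = 1 + - of_real (inverse (silver^2))" by simp
  then have e: "z^2 + of_real silver * z * (1 + - of_real (5 - 2 * silver))
      = of_real (silver^2) * - of_real (inverse (silver^2))"
    using assms by (subst (asm) phi_R_eq_iff) (simp_all only: inverse_silver_sq less_imp_le)
  have "silver^2 * inverse (silver^2) = 1"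
    using silver_bounds by simp
  then have "complex_of_real (silver^2) * - of_real (inverse (silver^2)) = - 1"
    by (metis mult_minus_right of_real_1 of_real_mult)
  moreover have "complex_of_real silver * (1 + - of_real (5 - 2 * silver)) = 2"
  proof -
    have "silver * (1 + - (5 - 2 * silver)) = 2"
      using silver_sq by (simp add: algebra_simps power2_eq_square)
    then show ?thesis
      by (metis of_real_1 of_real_add of_real_minus of_real_mult of_real_numeral)
  qed
  ultimately have "(z + 1)^2 = 0"
    using e by algebra
  then have "z = -1"
    by (simp add: add_eq_0_iff2)
  with assms show False by simp
qed

section \<open>Bounds for the sine on small discs\<close>

lemma sinh_le_mult_cosh:
  fixes y :: real
  assumes "0 \<le> y"
  shows "sinh y \<le> y * cosh y"
proof -
  have "0 * cosh 0 - sinh 0 \<le> y * cosh y - sinh y"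
    by (rule DERIV_nonneg_imp_nondecreasing[OF assms])
       (auto intro!: exI derivative_eq_intros)
  then show ?thesis by simp
qed

text \<open>
  On the circle of radius \<open>r\<close> the real part of the sine is \<open>sin (r cos t) cosh (r sin t)\<close>, and this
  decreases for \<open>t \<in> [0, \<pi>/2]\<close>.
\<close>

lemma abs_Re_sin_le:
  assumes z: "norm z \<le> 1/2"
  shows "\<bar>Re (sin z)\<bar> \<le> sin (norm z)"
proof (cases "z = 0")
  case False
  \<comment> \<open>Polar coordinates of \<open>z\<close> reflected into the closed first
    quadrant.\<close>
  define r t where "r = norm z" and "t = arccos (\<bar>Re z\<bar> / r)"
  have r: "0 < r" "r \<le> 1/2" using z False by (auto simp: r_def)
  have q: "0 \<le> \<bar>Re z\<bar> / r" "\<bar>Re z\<bar> / r \<le> 1"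
    using r abs_Re_le_cmod[of z] by (auto simp: r_def)
  have t: "0 \<le> t" "t \<le> pi/2"
    using q arccos_le_pi2[of "\<bar>Re z\<bar> / r"] by (auto simp: t_def arccos_lbound)
  have rc: "r * cos t = \<bar>Re z\<bar>"
    unfolding t_def using q r by (subst cos_arccos) (linarith, auto)
  have "(r * sin t)^2 = r^2 - (r * cos t)^2"
    by (simp add: power_mult_distrib sin_squared_eq algebra_simps)
  also have "\<dots> = \<bar>Im z\<bar>^2"
    unfolding rc unfolding r_def cmod_power2 by simp
  finally have "(r * sin t)^2 = \<bar>Im z\<bar>^2" .
  moreover have "0 \<le> r * sin t"
    using r t sin_ge_zero[of t] by simp
  ultimately have rs: "r * sin t = \<bar>Im z\<bar>"
    using power2_eq_imp_eq abs_ge_zero by blast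
  define G where "G = (\<lambda>t. sin (r * cos t) * cosh (r * sin t))"
  have "G t \<le> G 0"
  proof (rule DERIV_nonpos_imp_nonincreasing[OF t(1)])
    fix a assume "0 \<le> a" "a \<le> t"
    then have a: "0 \<le> sin a" "0 \<le> cos a"
      using t by (auto intro!: sin_ge_zero cos_ge_zero)
    define x y where "x = r * cos a" and "y = r * sin a"
    have x: "0 \<le> x" "x \<le> 1/2" and y: "0 \<le> y"
      using a r mult_mono[of r "1/2" "cos a" 1] by (auto simp: x_def y_def)
    have "\<bar>x * sin x\<bar> \<le> 1/2 * 1"
      unfolding abs_mult using x by (intro mult_mono) auto
    moreover have "1/2 = cos (pi/3)"
      by (simp add: cos_60)
    moreover have "cos (pi/3) \<le> cos x"
      using x pi_gt3 by (intro cos_monotone_0_pi_le) auto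
    ultimately have xx: "x * sin x \<le> cos x"
      by linarith
    have sx: "0 \<le> sin x"
      using x pi_gt3 by (intro sin_ge_zero) auto
    have "cos a * sin x * sinh y \<le> cos a * sin x * (y * cosh y)"
      using a sx sinh_le_mult_cosh[OF y] by (intro mult_left_mono mult_nonneg_nonneg) auto
    \<comment> \<open>The identity y cos a = x sin a makes both terms of the derivative
      comparable.\<close>
    also have "\<dots> = sin a * cosh y * (x * sin x)"
      by (simp add: x_def y_def)
    also have "\<dots> \<le> sin a * cosh y * cos x"
      using xx a by (intro mult_left_mono) auto
    finally have "r * (cos a * sin x * sinh y - sin a * cosh y * cos x) \<le> 0"
      using r by (intro mult_nonneg_nonpos) auto
    moreover have "(G has_real_derivative
        r * (cos a * sin x * sinh y - sin a * cosh y * cos x)) (at a)"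
      unfolding G_def x_def y_def by (auto intro!: derivative_eq_intros simp: algebra_simps)
    ultimately show "\<exists>D. (G has_real_derivative D) (at a) \<and> D \<le> 0"
      by blast
  qed
  moreover have "G t = \<bar>Re (sin z)\<bar>"
  proof -
    have "\<bar>Re z\<bar> \<le> pi"
      using abs_Re_le_cmod[of z] z pi_gt3 by linarith
    then have "\<bar>sin (Re z)\<bar> = sin \<bar>Re z\<bar>"
      using sin_ge_zero[of "Re z"] sin_ge_zero[of "- Re z"] by (auto simp: abs_if)
    moreover have "Re (sin z) = sin (Re z) * cosh (Im z)"
      by (simp add: Re_sin cosh_def)
    ultimately show ?thesis
      by (simp add: G_def rc rs abs_mult)
  qed
  ultimately show ?thesis
    by (simp add: G_def r_def)
qed auto

lemma sin_in_phi_R_region: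
  assumes z: "norm z < arcsin (inverse (silver^2))"
  shows "sin z \<in> phi_R_region"
proof -
  have b: "0 < inverse (silver^2)" "inverse (silver^2) < 1/5"
    unfolding inverse_silver_sq using silver_bounds by simp_all
  \<comment> \<open>This puts the critical radius below 1/4, small enough for the crude bound |sin
    z| \<le> 2|z| to give the modulus condition of the cap.\<close>
  have s14: "1/5 < sin (1/4::real)"
    using Maclaurin_sin_bound[of "1/4" 2]
    by (simp add: eval_nat_numeral sin_coeff_def abs_if split: if_splits)
  have "arcsin (inverse (silver^2)) < arcsin (sin (1/4))"
    using b s14 sin_le_one[of "1/4"] by (intro arcsin_less_arcsin) linarith+
  also have "\<dots> = 1/4"
    using pi_gt3 by (intro arcsin_sin) auto
  finally have z4: "norm z < 1/4"
    using z by simp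
  have "\<bar>Re (sin z)\<bar> \<le> sin (norm z)"
    using z4 by (intro abs_Re_sin_le) auto
  also have "\<dots> < sin (arcsin (inverse (silver^2)))"
    using z b arcsin_bounded[of "inverse (silver^2)"] norm_ge_zero[of z] pi_gt3
    by (intro sin_monotone_2pi) linarith+
  also have "\<dots> = inverse (silver^2)"
    using b by (intro sin_arcsin) linarith+
  finally have 1: "- inverse (silver^2) < Re (sin z)" by linarith
  have y: "\<bar>Im z\<bar> \<le> 1/4"
    using abs_Im_le_cmod[of z] z4 by linarith
  then have "\<bar>Im z\<bar>^2 \<le> (1/4)^2"
    by (intro power_mono) auto
  then have "exp \<bar>Im z\<bar> \<le> 2"
    using exp_bound[of "\<bar>Im z\<bar>"] y by (simp add: power2_eq_square)
  then have "exp \<bar>Im z\<bar> * norm z \<le> 2 * norm z"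
    by (intro mult_right_mono) auto
  moreover have "norm (sin z) \<le> exp \<bar>Im z\<bar> * norm z"
    using Taylor_sin[of z 0] by simp
  ultimately have "norm (sin z) < 1/2"
    using z4 by linarith
  with 1 show ?thesis
    by (simp add: phi_R_region_def)
qed

section \<open>Extremal functions\<close>

text \<open>Integrating f'/f = \<phi>/z gives f = z exp(Q - Q(0)), with Q a primitive of (\<phi> -
  1)/z; the subordinating map is the identity.\<close>

lemma starlike_class_extremal:
  assumes hol: "\<phi> holomorphic_on ball 0 1" and \<phi>0: "\<phi> 0 = 1"
  obtains f where "f \<in> starlike_class \<phi>" "\<And>z. z \<in> ball 0 1 \<Longrightarrow> star_quotient f z = \<phi> z"
proof -
  define q where "q = (\<lambda>z. if z = 0 then deriv \<phi> 0 else (\<phi> z - \<phi> 0) / (z - 0))"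
  have "q holomorphic_on ball 0 1"
    unfolding q_def using hol by (rule pole_lemma_open) auto
  then obtain Q where Q: "\<And>z. z \<in> ball 0 1 \<Longrightarrow> (Q has_field_derivative q z) (at z within ball 0 1)"
    using holomorphic_convex_primitive'[of "ball 0 1" q] by auto
  define f where "f = (\<lambda>z. z * exp (Q z - Q 0))"
  have Q': "(Q has_field_derivative q z) (at z)" if "z \<in> ball 0 1" for z
    using Q[OF that] that by (simp add: at_within_open[OF that])
  have f': "(f has_field_derivative exp (Q z - Q 0) * \<phi> z) (at z)" if "z \<in> ball 0 1" for z
  proof -
    have "(f has_field_derivative exp (Q z - Q 0) * (1 + z * q z)) (at z)"
      unfolding f_def by (auto intro!: derivative_eq_intros Q'[OF that] simp: algebra_simps)
    moreover have "1 + z * q z = \<phi> z"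
      by (simp add: q_def \<phi>0)
    ultimately show ?thesis by simp
  qed
  then have d: "deriv f z = exp (Q z - Q 0) * \<phi> z" if "z \<in> ball 0 1" for z
    using that by (intro DERIV_imp_deriv)
  have "f holomorphic_on ball 0 1"
    using f' holomorphic_on_open[OF open_ball] by blast
  then have A: "f \<in> class_A"
    using d[of 0] \<phi>0 by (simp add: class_A_def f_def)
  have sq: "star_quotient f z = \<phi> z" if "z \<in> ball 0 1" for z
    using d[OF that] by (simp add: star_quotient_def f_def \<phi>0)
  have "star_quotient f \<prec>\<^sub>s \<phi>"
    unfolding subordinate_def using sq by (intro exI[of _ id]) (auto simp: id_def)
  with A have "f \<in> starlike_class \<phi>"
    by (auto simp: starlike_class_def f_def)
  with sq that show thesis by blast
qed

section \<open>Dilations\<close>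

lemma scale_in_ball:
  fixes z :: complex
  assumes "0 < r" "r \<le> 1" "z \<in> ball 0 1"
  shows "of_real r * z \<in> ball 0 1"
  using assms mult_le_one[of r "norm z"] mult_right_mono[of r 1 "norm z"]
  by (auto simp: norm_mult)

lemma deriv_dilate:
  assumes f: "f \<in> class_A" and r: "0 < r" "r \<le> 1" and z: "z \<in> ball 0 1"
  shows "(dilate r f has_field_derivative deriv f (of_real r * z)) (at z)"
proof -
  have "(f has_field_derivative deriv f (of_real r * z)) (at (of_real r * z))"
    using f scale_in_ball[OF r z] by (auto simp: class_A_def intro!: holomorphic_derivI[where S = "ball 0 1"])
  then have "((\<lambda>z. f (of_real r * z)) has_field_derivative deriv f (of_real r * z) * of_real r) (at z)"
    by (rule DERIV_chain2) (auto intro!: derivative_eq_intros)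
  then show ?thesis
    unfolding dilate_def using r by (auto intro!: derivative_eq_intros)
qed

lemma dilate_class_A:
  assumes f: "f \<in> class_A" and r: "0 < r" "r \<le> 1"
  shows "dilate r f \<in> class_A"
proof -
  have "dilate r f holomorphic_on ball 0 1"
    using deriv_dilate[OF assms] holomorphic_on_open[OF open_ball] by blast
  moreover have "deriv (dilate r f) 0 = deriv f 0"
    using DERIV_imp_deriv[OF deriv_dilate[OF assms, of 0]] by simp
  ultimately show ?thesis
    using f by (simp add: class_A_def dilate_def)
qed

lemma star_quotient_dilate:
  assumes f: "f \<in> class_A" and r: "0 < r" "r \<le> 1" and z: "z \<in> ball 0 1"
  shows "star_quotient (dilate r f) z = star_quotient f (of_real r * z)"
  using DERIV_imp_deriv[OF deriv_dilate[OF assms]] r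
  by (simp add: star_quotient_def dilate_def)

section \<open>The two bounds for the radius\<close>

lemma dilate_starlike:
  assumes f: "f \<in> starlike_class phi_S" and r: "0 < r" "r \<le> arcsin (inverse (silver^2))" "r \<le> 1"
  shows "dilate r f \<in> starlike_class phi_R"
proof -
  have A: "f \<in> class_A" and nz: "\<And>z. z \<in> ball 0 1 - {0} \<Longrightarrow> f z \<noteq> 0"
    using f by (auto simp: starlike_class_def)
  obtain \<omega> where hol: "\<omega> holomorphic_on ball 0 1" and im: "\<omega> ` ball 0 1 \<subseteq> ball 0 1"
    and \<omega>0: "\<omega> 0 = 0" and eq: "\<And>z. z \<in> ball 0 1 \<Longrightarrow> star_quotient f z = phi_S (\<omega> z)"
    using f by (auto simp: starlike_class_def subordinate_def)
  \<comment> \<open>Schwarz gives |\<omega>(rz)| \<le> r|z| < r; the strict inequality lets the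
    critical radius itself be admissible.\<close>
  have schwarz: "norm (\<omega> z) \<le> norm z" if "z \<in> ball 0 1" for z
    using Schwarz_Lemma(1)[OF hol \<omega>0] im that by (auto simp: image_subset_iff)
  have reg: "sin (\<omega> (of_real r * z)) \<in> phi_R_region" if "z \<in> ball 0 1" for z
  proof (rule sin_in_phi_R_region)
    have "norm (\<omega> (of_real r * z)) \<le> r * norm z"
      using schwarz[OF scale_in_ball[OF r(1,3) that]] r by (simp add: norm_mult)
    also have "\<dots> < r"
      using that r by simp
    finally show "norm (\<omega> (of_real r * z)) < arcsin (inverse (silver^2))"
      using r by simp
  qed
  define \<omega>' where "\<omega>' = (\<lambda>z. phi_R_inv (sin (\<omega> (of_real r * z))))"
  have "(\<lambda>z. \<omega> (of_real r * z)) holomorphic_on ball 0 1"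
    by (rule holomorphic_on_compose_gen[OF _ hol, unfolded o_def])
      (auto intro!: holomorphic_intros dest: scale_in_ball[OF r(1,3)] simp del: mem_ball)
  then have "(\<lambda>z. sin (\<omega> (of_real r * z))) holomorphic_on ball 0 1"
    by (intro holomorphic_intros)
  then have "\<omega>' holomorphic_on ball 0 1"
    using holomorphic_on_compose_gen[OF _ holomorphic_phi_R_inv] reg
    unfolding \<omega>'_def o_def by blast
  moreover have "\<omega>' ` ball 0 1 \<subseteq> ball 0 1"
    using norm_phi_R_inv_less[OF reg] by (auto simp: \<omega>'_def)
  moreover have "\<omega>' 0 = 0"
    by (simp add: \<omega>'_def \<omega>0 phi_R_inv_0)
  moreover have "star_quotient (dilate r f) z = phi_R (\<omega>' z)" if "z \<in> ball 0 1" for z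
    using star_quotient_dilate[OF A r(1,3) that] eq[OF scale_in_ball[OF r(1,3) that]]
      phi_R_phi_R_inv[OF reg[OF that]]
    by (simp add: \<omega>'_def phi_S_def)
  ultimately have "star_quotient (dilate r f) \<prec>\<^sub>s phi_R"
    by (auto simp: subordinate_def)
  moreover have "dilate r f z \<noteq> 0" if "z \<in> ball 0 1 - {0}" for z
    using nz[of "of_real r * z"] scale_in_ball[OF r(1,3), of z] that r by (auto simp: dilate_def)
  ultimately show ?thesis
    using dilate_class_A[OF A r(1,3)] by (auto simp: starlike_class_def)
qed

lemma radius_le:
  assumes r: "0 < r" "r \<le> 1"
    and all: "\<forall>f\<in>starlike_class phi_S. dilate r f \<in> starlike_class phi_R"
  shows "r \<le> arcsin (inverse (silver^2))"
proof (rule ccontr)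
  define a where "a = arcsin (inverse (silver^2))"
  assume "\<not> r \<le> arcsin (inverse (silver^2))"
  then have ar: "a < r" by (simp add: a_def)
  have b: "0 < inverse (silver^2)" "inverse (silver^2) < 1"
    unfolding inverse_silver_sq using silver_bounds by simp_all
  have a0: "0 < a"
    using arcsin_less_arcsin[of 0 "inverse (silver^2)"] b by (simp add: a_def)
  obtain f where f: "f \<in> starlike_class phi_S"
    and sq: "\<And>z. z \<in> ball 0 1 \<Longrightarrow> star_quotient f z = phi_S z"
    using starlike_class_extremal[OF phi_S_admissible] by blast
  obtain \<omega> where im: "\<omega> ` ball 0 1 \<subseteq> ball 0 1"
    and eq: "\<And>z. z \<in> ball 0 1 \<Longrightarrow> star_quotient (dilate r f) z = phi_R (\<omega> z)"
    using all f by (auto simp: starlike_class_def subordinate_def)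
  \<comment> \<open>Chosen so that rz = -a, where \<open>phi_S\<close> takes the cusp value 1 - sin
    a; a < r puts it inside the disc.\<close>
  define z where "z = - complex_of_real (a / r)"
  have z: "z \<in> ball 0 1"
    using a0 ar by (simp add: z_def norm_divide)
  have rz: "of_real r * z = - complex_of_real a"
    using r by (simp add: z_def)
  have "phi_R (\<omega> z) = phi_S (- complex_of_real a)"
    using eq[OF z] star_quotient_dilate[OF _ r z, of f] sq[OF scale_in_ball[OF r z]] f rz
    by (simp add: starlike_class_def)
  also have "\<dots> = 1 - of_real (sin a)"
    by (simp add: phi_S_def sin_of_real)
  also have "sin a = inverse (silver^2)"
    unfolding a_def using b by (intro sin_arcsin) linarith+
  finally show False
    using phi_R_neq_cusp[of "\<omega> z"] im z by (auto simp: image_subset_iff)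
qed

theorem theorem7p9:
  shows "starlike_radius phi_R phi_S = arcsin (3 - 2 * sqrt 2)"
proof -
  define a where "a = arcsin (inverse (silver^2))"
  have b: "0 < inverse (silver^2)" "inverse (silver^2) < 1/2"
    unfolding inverse_silver_sq using silver_bounds by simp_all
  \<comment> \<open>These bounds place \<open>a\<close> in the interval over which the supremum is
    taken, so it is attained there.\<close>
  have "arcsin 0 < a" "a < arcsin (1/2)"
    unfolding a_def using b by (intro arcsin_less_arcsin; linarith)+
  then have a: "0 < a" "a \<le> 1"
    using pi_less_4 by simp_all
  have "starlike_radius phi_R phi_S = a"
    unfolding starlike_radius_def
    using a dilate_starlike radius_le by (intro cSup_eq_maximum) (auto simp: a_def)
  also have "inverse (silver^2) = 3 - 2 * sqrt 2"
    unfolding inverse_silver_sq by (simp add: silver_def)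
  then have "a = arcsin (3 - 2 * sqrt 2)"
    by (simp add: a_def)
  finally show ?thesis .
qed

end
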